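(* Let $\rho=3-2\sqrt2$, and let $r\ge0$ and $d\ge1$ be integers. The limit as $n\to\infty$ of the probability that the $r$th leaf in a random Schröder tree with $n+1$ leaves has depth $d$ exists. Denoting this limit by $p_{r,d}$, the generating function $\sum_{r\ge0}\sum_{d\ge1} p_{r,d}\, x^r y^d$ equals $$\frac{8y}{9-14y+13y^2+6\sqrt{2}(1-y)^2-(1+2y+5y^2)x+ \rho^{-1}(1-y)(1+3y)\sqrt{(1-x)(1-\rho^2 x)}}.$$
   Context: A plane tree is a rooted tree where the children of each node are linearly ordered. A Schröder tree is a plane tree where every internal (non-leaf) node has at least two children (the single-node tree is allowed and has one leaf). The leaves are ordered from left to right and indexed starting at $0$, so that the leftmost leaf is the $0$th leaf. The depth of a leaf is the number of edges in the path from the root to it. A random Schröder tree with $n+1$ leaves is chosen uniformly among all of them (with $n\ge r$). The identity is one of formal power series in $x,y$ with real coefficients. *)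

theory Defs
  imports
    "HOL-Probability.Probability"
    "HOL-Computational_Algebra.Formal_Power_Series"
begin

datatype plane_tree = Node "plane_tree list"

fun schroeder :: "plane_tree \<Rightarrow> bool" where
  "schroeder (Node ts) \<longleftrightarrow> ts = [] \<or> (length ts \<ge> 2 \<and> (\<forall>t\<in>set ts. schroeder t))"

text \<open>
  The depths of the leaves of a tree, listed from left to right: entry number \<open>r\<close> (counting
  from 0) is the depth of the \<open>r\<close>th leaf, and the length of the list is the number of leaves.
\<close>

fun leaf_depths :: "plane_tree \<Rightarrow> nat list" where
  "leaf_depths (Node ts) = (if ts = [] then [0] else map Suc (concat (map leaf_depths ts)))"

definition num_leaves :: "plane_tree \<Rightarrow> nat" where
  "num_leaves t = length (leaf_depths t)"

definition schroeder_trees :: "nat \<Rightarrow> plane_tree set" where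
  "schroeder_trees m = {t. schroeder t \<and> num_leaves t = m}"

lemma num_leaves_Node:
  "num_leaves (Node ts) = (if ts = [] then 1 else sum_list (map num_leaves ts))"
proof -
  have "map num_leaves ts = map length (map leaf_depths ts)" by (simp add: num_leaves_def)
  then show ?thesis by (simp add: num_leaves_def length_concat del: map_map)
qed

lemma num_leaves_pos: "num_leaves t \<ge> 1"
proof (induction t)
  case (Node ts)
  show ?case
  proof (cases ts)
    case (Cons t us)
    then show ?thesis using Node.IH[of t] by (simp add: num_leaves_Node)
  qed (simp add: num_leaves_Node)
qed

lemma length_le_sum_num_leaves: "length ts \<le> sum_list (map num_leaves ts)"
proof (induction ts)
  case (Cons t ts)
  then show ?case using num_leaves_pos[of t] by simp
qed simp

lemma num_leaves_child_less:
  assumes "length ts \<ge> 2" "t \<in> set ts"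
  shows "num_leaves t < num_leaves (Node ts)"
proof -
  obtain us vs where ts: "ts = us @ t # vs" using assms(2) by (meson split_list)
  have "length (us @ vs) \<ge> 1" using assms(1) ts by simp
  moreover have "length (us @ vs) \<le> sum_list (map num_leaves (us @ vs))"
    by (rule length_le_sum_num_leaves)
  ultimately have "1 \<le> sum_list (map num_leaves (us @ vs))" by linarith
  then show ?thesis unfolding ts num_leaves_Node by auto
qed

lemma finite_schroeder_trees: "finite (schroeder_trees m)"
proof (induction m rule: less_induct)
  case (less m)
  let ?C = "\<Union>k<m. schroeder_trees k"
  have "schroeder_trees m \<subseteq> insert (Node []) (Node ` {ts. set ts \<subseteq> ?C \<and> length ts \<le> m})"
  proof
    fix t assume t: "t \<in> schroeder_trees m"
    obtain ts where [simp]: "t = Node ts" by (cases t)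
    show "t \<in> insert (Node []) (Node ` {ts. set ts \<subseteq> ?C \<and> length ts \<le> m})"
    proof (cases "ts = []")
      case False
      with t have ts: "length ts \<ge> 2" "\<forall>u\<in>set ts. schroeder u" and m: "num_leaves (Node ts) = m"
        by (auto simp: schroeder_trees_def)
      have "set ts \<subseteq> ?C"
        using ts num_leaves_child_less[OF ts(1)] m by (auto simp: schroeder_trees_def)
      moreover have "length ts \<le> m"
        using length_le_sum_num_leaves[of ts] m False by (simp add: num_leaves_Node)
      ultimately show ?thesis by simp
    qed simp
  qed
  moreover have "finite ?C" using less.IH by blast
  then have "finite (insert (Node []) (Node ` {ts. set ts \<subseteq> ?C \<and> length ts \<le> m}))"
    by (intro finite.insertI finite_imageI finite_lists_length_le)
  ultimately show ?case by (rule finite_subset)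
qed

lemma schroeder_trees_nonempty: "schroeder_trees (n + 1) \<noteq> {}"
proof (cases n)
  case 0
  then have "Node [] \<in> schroeder_trees (n + 1)"
    by (simp add: schroeder_trees_def num_leaves_Node)
  then show ?thesis by blast
next
  case (Suc k)
  then have "Node (replicate (n + 1) (Node [])) \<in> schroeder_trees (n + 1)"
    by (simp add: schroeder_trees_def num_leaves_Node sum_list_replicate)
  then show ?thesis by blast
qed

text \<open>
  By the two preceding lemmas, \<open>pmf_of_set\<close> really denotes the uniform distribution here.
\<close>

definition random_schroeder :: "nat \<Rightarrow> plane_tree pmf" where
  "random_schroeder n = pmf_of_set (schroeder_trees (n + 1))"

text \<open>Only meaningful for \<open>n \<ge> r\<close>; otherwise there is no \<open>r\<close>th leaf and the list index is out of range.\<close>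

definition leaf_depth_prob :: "nat \<Rightarrow> nat \<Rightarrow> nat \<Rightarrow> real" where
  "leaf_depth_prob r d n =
     measure_pmf.prob (random_schroeder n) {t. leaf_depths t ! r = d}"

definition leaf_depth_limit :: "nat \<Rightarrow> nat \<Rightarrow> real" where
  "leaf_depth_limit r d = lim (leaf_depth_prob r d)"

text \<open>
  Formal power series in \<open>x\<close> and \<open>y\<close> are represented as power series in \<open>y\<close> (outer variable)
  whose coefficients are power series in \<open>x\<close> (inner variable).
\<close>

definition var_x :: "real fps fps" where "var_x = fps_const fps_X"

definition var_y :: "real fps fps" where "var_y = fps_X"

definition const_xy :: "real \<Rightarrow> real fps fps" where "const_xy c = fps_const (fps_const c)"

definition leaf_depth_gf :: "real fps fps" where
  "leaf_depth_gf = Abs_fps (\<lambda>d. Abs_fps (\<lambda>r. if d \<ge> 1 then leaf_depth_limit r d else 0))"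

text \<open>
  The formal square root of a power series in \<open>x\<close> alone with constant term 1: the root whose
  own constant term is \<open>root 2 1 = 1\<close>.
\<close>

definition sqrt_x :: "real fps \<Rightarrow> real fps fps" where
  "sqrt_x f = fps_const (fps_radical root 2 f)"

text \<open>
  Since \<^typ>\<open>real fps\<close> is not a field, the following records that division of formal power series
  in \<open>x\<close> and \<open>y\<close> is the true quotient whenever the divisor has nonzero constant term.
\<close>

lemma fps_fps_divide_mult_cancel:
  fixes f g :: "real fps fps"
  assumes "fps_nth (fps_nth g 0) 0 \<noteq> 0"
  shows "f / g * g = f"
proof -
  have g0: "fps_nth g 0 \<noteq> 0" using assms by auto
  have "fps_nth g 0 * inverse (fps_nth g 0) = 1"
    using assms by (rule inverse_mult_eq_1')
  then have "g * inverse g = 1"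
    unfolding fps_inverse_def by (rule fps_right_inverse)
  moreover have "f / g = f * inverse g" using g0 by (rule fps_divide_unit)
  ultimately show ?thesis by (metis mult.assoc mult.commute mult.right_neutral)
qed

lemma sqrt_x_square:
  assumes "fps_nth f 0 = 1"
  shows "(sqrt_x f)\<^sup>2 = fps_const f"
proof -
  have "fps_radical root (Suc 1) f ^ Suc 1 = f"
    using power_radical[of f root 1] assms by simp
  then show ?thesis by (simp add: sqrt_x_def numeral_2_eq_2)
qed

end

theory Submission
  imports Defs
begin

unbundle fps_syntax and no vec_syntax

text \<open>
  Why the theorem holds. Let \<open>A(t)\<close> be the generating function of ordered forests of Schroeder
  trees, counted by leaves. Everything rests on one algebraic fact (\<open>forest_gf_square\<close>):
  \<open>A\<^sup>2 = (3 - t) A - 2\<close>.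

  A tree whose leaf number \<open>r\<close> has depth \<open>d\<close> is a path of \<open>d\<close> edges; each of its internal nodes
  carries a forest to the left and a forest to the right of the path, not both empty. If \<open>u\<close> marks
  the leaves left of the chosen one and \<open>v\<close> those right of it, such trees are therefore counted by
  \<open>(A(u) A(v) - 1)\<^sup>d\<close> (\<open>marked_gf_eq\<close>), and expanding binomially reduces the limit of the
  probability to the behaviour, for fixed \<open>k\<close>, of the coefficients of \<open>A(v)\<^sup>k\<close> against those of
  \<open>A(v)\<close>.

  For \<open>k = 1\<close> one needs the ratio of consecutive coefficients. The series
  \<open>f = 3 - t - 2 A\<close> satisfies \<open>f\<^sup>2 = 1 - 6 t + t\<^sup>2\<close>, hence a first-order linear differential equation,
  hence a three-term recurrence. Its limiting form makes the ratio an orbit of a perturbation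
  of \<open>q \<mapsto> 6 - 1 / q\<close>, which contracts towards \<open>3 + 2 sqrt 2 = 1 / \<rho>\<close>
  (\<open>forest_gf_consecutive_ratio\<close>). For larger \<open>k\<close> no singularity analysis is needed: the quadratic
  equation gives a linear recurrence in \<open>k\<close> for the powers of \<open>A\<close>. Its limiting characteristic
  polynomial \<open>z\<^sup>2 - (3 - \<rho>) z + 2\<close> has the double root \<open>sqrt 2\<close>, the value of \<open>A\<close> at \<open>\<rho>\<close>, so the
  ratios tend to \<open>k (sqrt 2)\<close> to the power \<open>k - 1\<close> (\<open>forest_gf_power_ratio\<close>).

  Put \<open>B(x) = sqrt 2 A(\<rho> x)\<close>. Summing the limits over \<open>r\<close> gives
  \<open>sqrt 2 \<rho> d B (B - 1)\<close> with exponent \<open>d - 1\<close> on the last factor, and summing over \<open>d\<close> gives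
  \<open>sqrt 2 \<rho> B y / (1 - (B - 1) y)\<^sup>2\<close> (\<open>leaf_depth_gf_eq\<close>). The square root in the theorem is
  \<open>f(\<rho> x) = 3 - \<rho> x - 2 A(\<rho> x)\<close>, so the claimed denominator is affine in \<open>A(\<rho> x)\<close>, and reducing
  by the quadratic equation shows that both fractions agree (\<open>denominator_identity\<close>).
\<close>

section \<open>Schroeder trees and forests\<close>

definition schroeder_forests :: "nat \<Rightarrow> plane_tree list set" where
  "schroeder_forests m = {ts. (\<forall>t\<in>set ts. schroeder t) \<and> sum_list (map num_leaves ts) = m}"

lemma num_leaves_le_sum:
  assumes "t \<in> set ts"
  shows "num_leaves t \<le> sum_list (map num_leaves ts)"
  using assms by (simp add: member_le_sum_list)

lemma finite_schroeder_forests: "finite (schroeder_forests m)"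
proof (rule finite_subset)
  let ?C = "\<Union>k\<le>m. schroeder_trees k"
  show "schroeder_forests m \<subseteq> {ts. set ts \<subseteq> ?C \<and> length ts \<le> m}"
  proof
    fix ts assume "ts \<in> schroeder_forests m"
    then have ts: "\<forall>t\<in>set ts. schroeder t" "sum_list (map num_leaves ts) = m"
      by (auto simp: schroeder_forests_def)
    have "set ts \<subseteq> ?C"
      using ts num_leaves_le_sum[of _ ts] by (auto simp: schroeder_trees_def)
    then show "ts \<in> {ts. set ts \<subseteq> ?C \<and> length ts \<le> m}"
      using length_le_sum_num_leaves[of ts] ts by simp
  qed
  show "finite {ts. set ts \<subseteq> ?C \<and> length ts \<le> m}"
    by (intro finite_lists_length_le) (simp add: finite_schroeder_trees)
qed

definition tree_gf :: "real fps" where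
  "tree_gf = Abs_fps (\<lambda>n. real (card (schroeder_trees n)))"

definition forest_gf :: "real fps" where
  "forest_gf = Abs_fps (\<lambda>n. real (card (schroeder_forests n)))"

lemma forest_gf_nth: "forest_gf $ n = real (card (schroeder_forests n))"
  by (simp add: forest_gf_def)

lemma forest_gf_nth_pos: "forest_gf $ n > 0"
proof -
  have "replicate n (Node []) \<in> schroeder_forests n"
    by (auto simp: schroeder_forests_def sum_list_replicate num_leaves_Node)
  then show ?thesis
    using finite_schroeder_forests[of n] by (auto simp: forest_gf_nth card_gt_0_iff)
qed

lemma schroeder_forests_0: "schroeder_forests 0 = {[]}"
proof -
  have "ts = []" if "sum_list (map num_leaves ts) = 0" for ts
    using length_le_sum_num_leaves[of ts] that by simp
  then show ?thesis by (auto simp: schroeder_forests_def)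
qed

lemma schroeder_trees_0: "schroeder_trees 0 = {}"
proof -
  have "num_leaves t \<noteq> 0" for t using num_leaves_pos[of t] by simp
  then show ?thesis by (simp add: schroeder_trees_def)
qed

lemma schroeder_forests_Suc_Cons:
  "schroeder_forests (Suc n) =
     (\<lambda>(i, t, ts). t # ts) `
       (SIGMA i:{..Suc n}. schroeder_trees i \<times> schroeder_forests (Suc n - i))" (is "?L = ?R")
proof
  show "?L \<subseteq> ?R"
  proof
    fix us assume us: "us \<in> ?L"
    then obtain t ts where [simp]: "us = t # ts" by (cases us) (auto simp: schroeder_forests_def)
    have "(num_leaves t, t, ts) \<in>
      (SIGMA i:{..Suc n}. schroeder_trees i \<times> schroeder_forests (Suc n - i))"
      using us by (auto simp: schroeder_forests_def schroeder_trees_def)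
    then show "us \<in> ?R" by (rule rev_image_eqI) simp
  qed
  show "?R \<subseteq> ?L" by (auto simp: schroeder_forests_def schroeder_trees_def)
qed

text \<open>
  A nonempty forest is its first tree followed by a forest.
\<close>

lemma forest_gf_eq: "forest_gf = 1 + tree_gf * forest_gf"
proof (rule fps_ext)
  fix n show "forest_gf $ n = (1 + tree_gf * forest_gf) $ n"
  proof (cases n)
    case 0
    then show ?thesis
      by (simp add: forest_gf_def tree_gf_def schroeder_forests_0 schroeder_trees_0)
  next
    case (Suc m)
    have inj: "inj_on (\<lambda>(i, t, ts). t # ts)
        (SIGMA i:{..Suc m}. schroeder_trees i \<times> schroeder_forests (Suc m - i))"
      by (auto simp: inj_on_def schroeder_trees_def)
    have "card (schroeder_forests (Suc m)) =
        (\<Sum>i\<le>Suc m. card (schroeder_trees i) * card (schroeder_forests (Suc m - i)))"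
      unfolding schroeder_forests_Suc_Cons[of m] card_image[OF inj]
      by (subst card_SigmaI)
        (auto simp: finite_schroeder_trees finite_schroeder_forests card_cartesian_product)
    then have "real (card (schroeder_forests (Suc m))) =
        (\<Sum>i\<le>Suc m. real (card (schroeder_trees i)) * real (card (schroeder_forests (Suc m - i))))"
      by (simp only: of_nat_sum of_nat_mult)
    then have "forest_gf $ Suc m = (tree_gf * forest_gf) $ Suc m"
      by (simp only: forest_gf_def tree_gf_def fps_mult_nth atLeast0AtMost fps_nth_Abs_fps)
    then show ?thesis by (simp add: Suc)
  qed
qed

text \<open>
  A tree is a single leaf or arises from a forest of at least two trees by adding a root; the other
  forests are the empty one and the single trees. Eliminating the number of forests of at least two
  trees from the resulting two equations leaves a linear relation.
\<close>

lemma forest_gf_tree_gf: "2 * tree_gf = fps_X + forest_gf - 1"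
proof (rule fps_ext)
  fix n show "(2 * tree_gf) $ n = (fps_X + forest_gf - 1) $ n"
  proof (cases n)
    case 0
    then show ?thesis
      by (simp add: forest_gf_def tree_gf_def schroeder_forests_0 schroeder_trees_0 fps_numeral_nth)
  next
    case (Suc m)
    let ?leaf = "{t. t = Node [] \<and> n = 1}"
    let ?long = "{ts \<in> schroeder_forests n. length ts \<ge> 2}"
    have long_fin: "finite ?long" by (simp add: finite_schroeder_forests)
    have trees: "schroeder_trees n = ?leaf \<union> Node ` ?long"
    proof (intro set_eqI)
      fix t
      obtain ts where "t = Node ts" by (cases t)
      then show "t \<in> schroeder_trees n \<longleftrightarrow> t \<in> ?leaf \<union> Node ` ?long"
        by (auto simp: schroeder_trees_def schroeder_forests_def num_leaves_Node image_iff)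
    qed
    have forests: "schroeder_forests n = (\<lambda>t. [t]) ` schroeder_trees n \<union> ?long"
    proof (intro set_eqI)
      fix ts :: "plane_tree list"
      consider "ts = []" | t where "ts = [t]" | "length ts \<ge> 2"
        by (cases ts rule: remdups_adj.cases) auto
      then show "ts \<in> schroeder_forests n \<longleftrightarrow> ts \<in> (\<lambda>t. [t]) ` schroeder_trees n \<union> ?long"
        by cases (auto simp: schroeder_trees_def schroeder_forests_def image_iff Suc)
    qed
    have "card (schroeder_forests n) = card ((\<lambda>t. [t]) ` schroeder_trees n) + card ?long"
      by (subst forests, subst card_Un_disjoint)
        (auto simp: finite_schroeder_trees long_fin)
    also have "card ((\<lambda>t. [t]) ` schroeder_trees n) = card (schroeder_trees n)"
      by (simp add: card_image inj_on_def)
    finally have 1: "card (schroeder_forests n) = card (schroeder_trees n) + card ?long" .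
    have "card (schroeder_trees n) = card ?leaf + card (Node ` ?long)"
      by (subst trees, subst card_Un_disjoint)
        (auto simp: long_fin)
    also have "card (Node ` ?long) = card ?long"
      by (simp add: card_image inj_on_def)
    also have "card ?leaf = (if n = 1 then 1 else 0)"
      by (cases "n = 1") auto
    finally have 2: "card (schroeder_trees n) = (if n = 1 then 1 else 0) + card ?long" .
    show ?thesis
      using 1 2 Suc by (auto simp: forest_gf_def tree_gf_def fps_X_nth numeral_fps_const)
  qed
qed

text \<open>
  Eliminating the tree series from the two preceding relations. The degree two of this equation,
  with the constant coefficient 2, is what makes all later limits explicit.
\<close>

lemma forest_gf_square: "forest_gf\<^sup>2 = (3 - fps_X) * forest_gf - 2"
proof -
  have "2 * forest_gf = 2 + (2 * tree_gf) * forest_gf"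
    using forest_gf_eq by (metis distrib_left mult.assoc mult.right_neutral)
  then have eq: "2 * forest_gf = 2 + (fps_X + forest_gf - 1) * forest_gf"
    by (simp only: forest_gf_tree_gf)
  have "forest_gf\<^sup>2 - ((3 - fps_X) * forest_gf - 2) =
      2 + (fps_X + forest_gf - 1) * forest_gf - 2 * forest_gf"
    by (simp add: algebra_simps power2_eq_square)
  also have "\<dots> = 0" unfolding right_minus_eq by (rule eq[symmetric])
  finally show ?thesis by (simp only: right_minus_eq)
qed

section \<open>Trees with a marked leaf\<close>

text \<open>
  The marked leaf has \<open>r\<close> leaves to its left, \<open>m\<close> to its right, and depth \<open>d\<close>. Counting the two
  sides separately makes the decomposition at the root multiplicative.
\<close>

definition marked_trees :: "nat \<Rightarrow> nat \<Rightarrow> nat \<Rightarrow> plane_tree set" where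
  "marked_trees d r m = {t \<in> schroeder_trees (r + 1 + m). leaf_depths t ! r = d}"

lemma finite_marked_trees: "finite (marked_trees d r m)"
  by (simp add: marked_trees_def finite_schroeder_trees)

lemma marked_trees_0: "marked_trees 0 r m = (if r = 0 \<and> m = 0 then {Node []} else {})"
proof -
  have 1: "t = Node [] \<and> r = 0 \<and> m = 0" if t: "t \<in> marked_trees 0 r m" for t
  proof -
    obtain ts where ts: "t = Node ts" by (cases t)
    have len: "r < length (leaf_depths t)" "length (leaf_depths t) = r + 1 + m" and z: "leaf_depths t ! r = 0"
      using t by (auto simp: marked_trees_def schroeder_trees_def num_leaves_def)
    have "ts = []"
    proof (rule ccontr)
      assume "ts \<noteq> []"
      then have "leaf_depths t = map Suc (concat (map leaf_depths ts))" by (simp add: ts)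
      then have "leaf_depths t ! r \<noteq> 0" using len(1) by simp
      then show False using z by simp
    qed
    then show ?thesis using ts len by simp
  qed
  have 2: "Node [] \<in> marked_trees 0 0 0"
    by (simp add: marked_trees_def schroeder_trees_def num_leaves_def)
  show ?thesis
  proof (rule set_eqI)
    show "t \<in> marked_trees 0 r m \<longleftrightarrow> t \<in> (if r = 0 \<and> m = 0 then {Node []} else {})" for t
      using 1[of t] 2 by auto
  qed
qed

lemma leaf_depths_child:
  assumes "sum_list (map num_leaves ls) = i" "j < num_leaves t"
  shows "leaf_depths (Node (ls @ t # rs)) ! (i + j) = Suc (leaf_depths t ! j)"
proof -
  have len: "length (concat (map leaf_depths ls)) = i"
    using assms(1) by (simp add: length_concat num_leaves_def[abs_def] comp_def)
  have "leaf_depths (Node (ls @ t # rs)) ! (i + j) =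
      (map Suc (concat (map leaf_depths ls)) @ map Suc (leaf_depths t) @
         map Suc (concat (map leaf_depths rs))) ! (i + j)"
    by simp
  also have "\<dots> = Suc (leaf_depths t ! j)"
    using assms(2) len by (simp add: nth_append num_leaves_def)
  finally show ?thesis .
qed

lemma forest_split_at_leaf:
  assumes "r < sum_list (map num_leaves ts)"
  shows "\<exists>ls t rs j. ts = ls @ t # rs \<and> r = sum_list (map num_leaves ls) + j \<and> j < num_leaves t"
  using assms
proof (induction ts arbitrary: r)
  case (Cons t ts)
  show ?case
  proof (cases "r < num_leaves t")
    case True
    then have "t # ts = [] @ t # ts \<and> r = sum_list (map num_leaves []) + r \<and> r < num_leaves t"
      by simp
    then show ?thesis by blast
  next
    case False
    then have "r - num_leaves t < sum_list (map num_leaves ts)" using Cons.prems by simp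
    from Cons.IH[OF this] obtain ls u rs j where *: "ts = ls @ u # rs"
      "r - num_leaves t = sum_list (map num_leaves ls) + j" "j < num_leaves u" by blast
    then have "t # ts = (t # ls) @ u # rs \<and> r = sum_list (map num_leaves (t # ls)) + j \<and> j < num_leaves u"
      using False by simp
    then show ?thesis by blast
  qed
qed simp

text \<open>
  If the two left parts had different lengths, the longer one would contain the tree holding leaf
  \<open>r\<close> of the other splitting, and hence more than \<open>r\<close> leaves.
\<close>

lemma forest_split_at_leaf_unique:
  assumes eq: "ls @ t # rs = ls' @ t' # rs'"
    and "sum_list (map num_leaves ls) \<le> r" "r < sum_list (map num_leaves ls) + num_leaves t"
    and "sum_list (map num_leaves ls') \<le> r" "r < sum_list (map num_leaves ls') + num_leaves t'"
  shows "ls = ls' \<and> t = t' \<and> rs = rs'"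
  using eq unfolding append_eq_append_conv2
  using assms(2-) by (auto simp: Cons_eq_append_conv append_eq_Cons_conv)

text \<open>
  The data seen from the root of a marked tree: the forests left and right of the child that contains
  the marked leaf, their numbers of leaves, and that child with its marked leaf.
\<close>

definition zippers :: "nat \<Rightarrow> nat \<Rightarrow> nat \<Rightarrow> (nat \<times> nat \<times> plane_tree list \<times> plane_tree list \<times> plane_tree) set" where
  "zippers d r m = (SIGMA i:{..r}. SIGMA j:{..m}.
     schroeder_forests i \<times> schroeder_forests j \<times> marked_trees d (r - i) (m - j))"

lemma card_zippers:
  "card (zippers d r m) = (\<Sum>i\<le>r. \<Sum>j\<le>m. card (schroeder_forests i) *
     (card (schroeder_forests j) * card (marked_trees d (r - i) (m - j))))"
  unfolding zippers_def
  by (simp add: card_SigmaI finite_schroeder_forests finite_marked_trees card_cartesian_product)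

lemma zippers_iff:
  "(i, j, ls, rs, t) \<in> zippers d r m \<longleftrightarrow>
     i = sum_list (map num_leaves ls) \<and> j = sum_list (map num_leaves rs) \<and> i \<le> r \<and> j \<le> m \<and>
     (\<forall>t\<in>set (ls @ rs). schroeder t) \<and> t \<in> marked_trees d (r - i) (m - j)"
  by (auto simp: zippers_def schroeder_forests_def)

text \<open>
  Joining the three parts of a zipper under a new root is injective and increases the depth of the
  marked leaf by one. It yields exactly the marked Schroeder trees of positive depth, except that
  two empty side forests would give a root with a single child; these zippers correspond to the
  marked trees of depth \<open>d\<close> themselves and are counted by the second summand.
\<close>

lemma card_marked_trees_Suc:
  "card (marked_trees (Suc d) r m) + card (marked_trees d r m) = card (zippers d r m)"
proof -
  define plug :: "nat \<times> nat \<times> plane_tree list \<times> plane_tree list \<times> plane_tree \<Rightarrow> plane_tree" where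
    "plug = (\<lambda>(i, j, ls, rs, t). Node (ls @ t # rs))"
  \<comment> \<open>The zippers with empty side forests, which \<open>plug\<close> would send to a root with one child.\<close>
  define triv where "triv = (\<lambda>t. (0::nat, 0::nat, []::plane_tree list, []::plane_tree list, t)) ` marked_trees d r m"
  have triv_sub: "triv \<subseteq> zippers d r m"
    by (auto simp: triv_def zippers_iff)
  have fin: "finite (zippers d r m)"
    unfolding zippers_def
    by (intro finite_SigmaI finite_cartesian_product) (auto simp: finite_schroeder_forests finite_marked_trees)
  have inj: "inj_on plug (zippers d r m)"
  proof (rule inj_onI)
    fix p q assume p: "p \<in> zippers d r m" and q: "q \<in> zippers d r m" and eq: "plug p = plug q"
    obtain i j ls rs t where [simp]: "p = (i, j, ls, rs, t)" by (cases p) auto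
    obtain i' j' ls' rs' t' where [simp]: "q = (i', j', ls', rs', t')" by (cases q) auto
    have "ls = ls' \<and> t = t' \<and> rs = rs'"
      using p q eq
      by (intro forest_split_at_leaf_unique[where r = r])
        (auto simp: zippers_iff plug_def marked_trees_def schroeder_trees_def)
    then show "p = q" using p q by (simp add: zippers_iff)
  qed
  have image: "plug ` (zippers d r m - triv) = marked_trees (Suc d) r m"
  proof (intro set_eqI iffI)
    fix u assume "u \<in> plug ` (zippers d r m - triv)"
    then obtain i j ls rs t where u: "u = Node (ls @ t # rs)" and z: "(i, j, ls, rs, t) \<in> zippers d r m"
      and nt: "(i, j, ls, rs, t) \<notin> triv" by (auto simp: plug_def)
    from z have ls: "i = sum_list (map num_leaves ls)" "i \<le> r" and rs: "j = sum_list (map num_leaves rs)" "j \<le> m"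
      and sch: "\<forall>t\<in>set (ls @ rs). schroeder t" and t: "t \<in> marked_trees d (r - i) (m - j)"
      by (auto simp: zippers_iff)
    have ne: "ls \<noteq> [] \<or> rs \<noteq> []"
      using nt t ls rs by (auto simp: triv_def)
    have t': "schroeder t" "num_leaves t = (r - i) + 1 + (m - j)" "leaf_depths t ! (r - i) = d"
      using t by (auto simp: marked_trees_def schroeder_trees_def)
    have "leaf_depths u ! (i + (r - i)) = Suc (leaf_depths t ! (r - i))"
      unfolding u using ls t' by (intro leaf_depths_child) auto
    moreover have "schroeder u" using ne sch t' by (auto simp: u Suc_le_eq)
    moreover have "num_leaves u = r + 1 + m" using ls rs t' by (simp add: u num_leaves_Node)
    ultimately show "u \<in> marked_trees (Suc d) r m"
      using ls t' by (simp add: marked_trees_def schroeder_trees_def)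
  next
    fix u assume u: "u \<in> marked_trees (Suc d) r m"
    obtain ts where ts: "u = Node ts" by (cases u)
    have u': "schroeder u" "num_leaves u = r + 1 + m" "leaf_depths u ! r = Suc d"
      using u by (auto simp: marked_trees_def schroeder_trees_def)
    have "ts \<noteq> []"
    proof
      assume "ts = []"
      then show False using u' by (cases r) (auto simp: ts num_leaves_def)
    qed
    then have len: "length ts \<ge> 2" and sch: "\<forall>t\<in>set ts. schroeder t"
      and sum: "sum_list (map num_leaves ts) = r + 1 + m"
      using u' by (auto simp: ts num_leaves_Node)
    obtain ls t rs j where split: "ts = ls @ t # rs" "r = sum_list (map num_leaves ls) + j" "j < num_leaves t"
      using forest_split_at_leaf[of r ts] sum by auto
    have "leaf_depths t ! j = d"
      using leaf_depths_child[OF refl split(3), of ls rs] u' split ts by simp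
    then have "(sum_list (map num_leaves ls), sum_list (map num_leaves rs), ls, rs, t) \<in> zippers d r m"
      using sch sum split by (auto simp: zippers_iff marked_trees_def schroeder_trees_def)
    moreover have "(sum_list (map num_leaves ls), sum_list (map num_leaves rs), ls, rs, t) \<notin> triv"
      using len split by (auto simp: triv_def)
    moreover have "u = plug (sum_list (map num_leaves ls), sum_list (map num_leaves rs), ls, rs, t)"
      by (simp add: plug_def ts split)
    ultimately show "u \<in> plug ` (zippers d r m - triv)" by blast
  qed
  have "card (marked_trees (Suc d) r m) = card (zippers d r m - triv)"
    unfolding image[symmetric] by (intro card_image inj_on_subset[OF inj]) auto
  also have "\<dots> = card (zippers d r m) - card triv"
    using triv_sub fin by (intro card_Diff_subset) (auto intro: finite_subset)
  finally have "card (marked_trees (Suc d) r m) = card (zippers d r m) - card triv" .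
  moreover have "card triv \<le> card (zippers d r m)"
    using triv_sub fin by (rule card_mono[rotated])
  moreover have "card triv = card (marked_trees d r m)"
    unfolding triv_def by (intro card_image) (auto simp: inj_on_def)
  ultimately show ?thesis by simp
qed

text \<open>
  In the ring of power series over power series, this is \<open>f\<close> in the outer variable, whereas
  \<^const>\<open>fps_const\<close> \<open>f\<close> is \<open>f\<close> in the inner variable.
\<close>

definition lift_fps :: "'a::comm_ring_1 fps \<Rightarrow> 'a fps fps" where
  "lift_fps f = Abs_fps (\<lambda>n. fps_const (f $ n))"

lemma fps_const_sum: "fps_const (sum f I) = (\<Sum>i\<in>I. fps_const (f i))"
  by (induction I rule: infinite_finite_induct) (auto simp flip: fps_const_add)

lemma lift_fps_mult: "lift_fps (f * g) = lift_fps f * lift_fps g"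
  by (rule fps_ext) (simp add: lift_fps_def fps_mult_nth fps_const_sum)

lemma lift_fps_power: "lift_fps (f ^ k) = lift_fps f ^ k"
proof (induction k)
  case 0
  show ?case by (rule fps_ext) (simp add: lift_fps_def)
qed (simp add: lift_fps_mult)

definition marked_gf :: "nat \<Rightarrow> real fps fps" where
  "marked_gf d = Abs_fps (\<lambda>r. Abs_fps (\<lambda>m. real (card (marked_trees d r m))))"

lemma marked_gf_Suc:
  "marked_gf (Suc d) + marked_gf d = lift_fps forest_gf * (fps_const forest_gf * marked_gf d)"
proof (intro fps_ext)
  fix r m
  have "(marked_gf (Suc d) + marked_gf d) $ r $ m = real (card (zippers d r m))"
    unfolding card_marked_trees_Suc[symmetric] by (simp add: marked_gf_def)
  also have "\<dots> = (lift_fps forest_gf * (fps_const forest_gf * marked_gf d)) $ r $ m"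
    unfolding fps_mult_nth[of "lift_fps forest_gf"] fps_sum_nth
    by (simp add: card_zippers lift_fps_def fps_mult_nth[of forest_gf] forest_gf_nth marked_gf_def
        atLeast0AtMost sum_distrib_left)
  finally show "(marked_gf (Suc d) + marked_gf d) $ r $ m = \<dots>" .
qed

lemma marked_gf_eq: "marked_gf d = (lift_fps forest_gf * fps_const forest_gf - 1) ^ d"
proof (induction d)
  case 0
  show ?case
    by (intro fps_ext) (simp add: marked_gf_def marked_trees_0)
next
  case (Suc d)
  have "marked_gf (Suc d) = (lift_fps forest_gf * fps_const forest_gf - 1) * marked_gf d"
    using marked_gf_Suc[of d] by (simp add: algebra_simps eq_diff_eq)
  then show ?case using Suc by simp
qed

lemma card_marked_trees:
  "real (card (marked_trees d r m)) =
     (\<Sum>k\<le>d. of_nat (d choose k) * (-1) ^ (d - k) * (forest_gf ^ k $ r * forest_gf ^ k $ m))"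
proof -
  have "marked_gf d = (\<Sum>k\<le>d. of_nat (d choose k) * (lift_fps (forest_gf ^ k) * fps_const (forest_gf ^ k)) * (-1) ^ (d - k))"
    unfolding marked_gf_eq diff_conv_add_uminus binomial_ring
    by (simp add: power_mult_distrib lift_fps_power fps_const_power)
  also have "\<dots> = (\<Sum>k\<le>d. fps_const (fps_const (of_nat (d choose k) * (-1) ^ (d - k))) * (lift_fps (forest_gf ^ k) * fps_const (forest_gf ^ k)))"
    by (intro sum.cong refl) (simp add: fps_of_nat mult_ac flip: fps_const_mult fps_const_power fps_const_neg)
  finally have "marked_gf d $ r $ m = (\<Sum>k\<le>d. of_nat (d choose k) * (-1) ^ (d - k) * (forest_gf ^ k $ r * forest_gf ^ k $ m))"
    by (simp add: fps_sum_nth lift_fps_def)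
  then show ?thesis by (simp add: marked_gf_def)
qed

section \<open>Growth of the number of forests\<close>

text \<open>
  Differentiating gives \<open>f f' = X - 3\<close>, and multiplying by \<open>f\<close> turns this into the linear equation
  \<open>(1 - 6 X + X\<^sup>2) f' = (X - 3) f\<close>, whose coefficients are compared.
\<close>

lemma sqrt_fps_recurrence:
  fixes f :: "real fps"
  assumes f: "f\<^sup>2 = 1 - 6 * fps_X + fps_X\<^sup>2"
  shows "real (n + 2) * f $ (n + 2) = (6 * real n + 3) * f $ (n + 1) - (real n - 1) * f $ n"
proof -
  have "fps_deriv (f\<^sup>2) = fps_deriv (1 - 6 * fps_X + fps_X\<^sup>2)" by (simp only: f)
  then have "2 * (f * fps_deriv f) = 2 * (fps_X - 3)"
    by (simp add: power2_eq_square algebra_simps)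
  then have 1: "f * fps_deriv f = fps_X - 3"
    by (subst (asm) mult_left_cancel) simp_all
  have "(1 - 6 * fps_X + fps_X\<^sup>2) * fps_deriv f = f * (f * fps_deriv f)"
    unfolding f[symmetric] by (simp add: power2_eq_square mult.assoc)
  also have "\<dots> = (fps_X - 3) * f" unfolding 1 by (rule mult.commute)
  finally have "fps_deriv f - fps_const 6 * (fps_X * fps_deriv f) + fps_X * (fps_X * fps_deriv f)
      = fps_X * f - fps_const 3 * f"
    by (simp add: algebra_simps power2_eq_square numeral_fps_const)
  then have "(fps_deriv f - fps_const 6 * (fps_X * fps_deriv f) + fps_X * (fps_X * fps_deriv f)) $ (n + 1)
      = (fps_X * f - fps_const 3 * f) $ (n + 1)"
    by (simp only:)
  then show ?thesis
    by (cases n) (simp_all add: algebra_simps)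
qed

text \<open>
  A contraction with perturbations of order \<open>1 / n\<close> keeps an error of that order: half of
  \<open>6 D / (n + 2)\<close> plus one further \<open>D / (n + 2)\<close> is \<open>4 D / (n + 2)\<close>, which is at most
  \<open>6 D / (n + 3)\<close> for every \<open>n\<close>.
\<close>

lemma perturbed_contraction_bound:
  fixes e :: "nat \<Rightarrow> real"
  assumes step: "\<And>n. e (Suc n) \<le> e n / 2 + D / real (n + 2)" and "e 0 \<le> 3 * D" and "D \<ge> 0"
  shows "e n \<le> 6 * D / real (n + 2)"
proof (induction n)
  case (Suc n)
  have "e (Suc n) \<le> (6 * D / real (n + 2)) / 2 + D / real (n + 2)"
    by (rule order_trans[OF step add_right_mono[OF divide_right_mono[OF Suc]]]) simp
  also have "\<dots> = D * (4 / real (n + 2))"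
  proof -
    have "6 * D / x / 2 + D / x = D * (4 / x)" for x :: real
      by (cases "x = 0") (simp_all add: field_simps)
    then show ?thesis .
  qed
  also have "\<dots> \<le> D * (6 / real (Suc n + 2))"
    using assms(3) by (intro mult_left_mono) (simp_all add: field_simps)
  finally show ?case by (simp add: mult.commute)
qed (use assms in simp)

text \<open>
  Completing the square in the quadratic equation, \<open>3 - X - 2 A\<close> is a square root of
  \<open>(3 - X)\<^sup>2 - 8 = 1 - 6 X + X\<^sup>2\<close>, and from degree 2 on its coefficients are those of \<open>- 2 A\<close>.
\<close>

lemma forest_gf_recurrence:
  "real (n + 4) * forest_gf $ (n + 4) =
     (6 * real n + 15) * forest_gf $ (n + 3) - (real n + 1) * forest_gf $ (n + 2)"
  "forest_gf $ 3 = 3 * forest_gf $ 2"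
proof -
  define f where "f = 3 - fps_X - 2 * forest_gf"
  have "f\<^sup>2 = (3 - fps_X)\<^sup>2 - 4 * ((3 - fps_X) * forest_gf - forest_gf\<^sup>2)"
    unfolding f_def by (simp add: power2_eq_square algebra_simps)
  also have "\<dots> = 1 - 6 * fps_X + fps_X\<^sup>2"
    unfolding forest_gf_square by (simp add: power2_eq_square algebra_simps)
  finally have f2: "f\<^sup>2 = 1 - 6 * fps_X + fps_X\<^sup>2" .
  have f_nth: "f $ n = - 2 * forest_gf $ n" if "n \<ge> 2" for n
    using that by (simp add: f_def numeral_fps_const)
  show "real (n + 4) * forest_gf $ (n + 4) =
      (6 * real n + 15) * forest_gf $ (n + 3) - (real n + 1) * forest_gf $ (n + 2)"
    using sqrt_fps_recurrence[OF f2, of "n + 2"] by (simp add: f_nth algebra_simps eval_nat_numeral)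
  show "forest_gf $ 3 = 3 * forest_gf $ 2"
    using sqrt_fps_recurrence[OF f2, of 1] by (simp add: f_nth eval_nat_numeral)
qed

text \<open>
  By the recurrence, the ratio \<open>q\<close> of consecutive coefficients evolves under \<open>q \<mapsto> 6 - 1 / q\<close> up to
  an error of order \<open>1 / n\<close>. The limit \<open>c = 3 + 2 sqrt 2\<close> is a fixed point of this map, and the
  bounds \<open>q \<ge> 2\<close> and \<open>c \<ge> 1\<close> make it contract by a factor of at least two.
\<close>

lemma forest_gf_consecutive_ratio:
  "(\<lambda>n. forest_gf $ Suc n / forest_gf $ n) \<longlonglongrightarrow> 3 + 2 * sqrt 2"
proof -
  define c where "c = 3 + 2 * sqrt 2"
  have c: "c * c = 6 * c - 1" "c \<ge> 1" by (simp_all add: c_def algebra_simps)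
  define q where "q n = forest_gf $ (n + 3) / forest_gf $ (n + 2)" for n
  \<comment> \<open>Index 2 is the first from which the coefficients of \<open>A\<close> follow the recurrence.\<close>
  have q_Suc: "q (Suc n) = (6 * real n + 15) / real (n + 4) - (real n + 1) / (real (n + 4) * q n)" for n
  proof -
    have "forest_gf $ (n + 4) = ((6 * real n + 15) * forest_gf $ (n + 3) - (real n + 1) * forest_gf $ (n + 2)) / real (n + 4)"
      unfolding forest_gf_recurrence(1)[symmetric] by simp
    then have "q (Suc n) = ((6 * real n + 15) * forest_gf $ (n + 3) - (real n + 1) * forest_gf $ (n + 2)) / real (n + 4) / forest_gf $ (n + 3)"
      by (simp add: q_def eval_nat_numeral)
    then show ?thesis
      using forest_gf_nth_pos[of "n + 3"] forest_gf_nth_pos[of "n + 2"]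
      by (simp add: q_def diff_divide_distrib)
  qed
  have q_ge: "q n \<ge> 2" for n
  proof (induction n)
    case 0
    show ?case
      using forest_gf_recurrence(2) forest_gf_nth_pos[of 2] by (simp add: q_def eval_nat_numeral)
  next
    case (Suc n)
    have "(real n + 1) / (real (n + 4) * q n) \<le> (real n + 1) / (real (n + 4) * 2)"
      using Suc by (intro divide_left_mono mult_left_mono) auto
    moreover have "2 + (real n + 1) / (real (n + 4) * 2) \<le> (6 * real n + 15) / real (n + 4)"
      by (simp add: field_simps)
    ultimately show ?case unfolding q_Suc by linarith
  qed
  have bound: "\<bar>q n - c\<bar> \<le> 6 * 9 / real (n + 2)" for n
  proof (rule perturbed_contraction_bound)
    fix n
    have "q n > 0" using q_ge[of n] by simp
    have "q (Suc n) - c = (3 / q n - 9) / real (n + 4) + (q n - c) / (q n * c)"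
    proof -
      have "q (Suc n) = 6 - 1 / q n + (3 / q n - 9) / real (n + 4)"
      proof -
        have "(6 * m - 9) / m - (m - 3) / (m * x) = 6 - 1 / x + (3 / x - 9) / m"
          if "m > 0" "x > 0" for m x :: real
          using that by (simp add: field_simps)
        from this[of "real n + 4" "q n"] show ?thesis
          unfolding q_Suc using \<open>q n > 0\<close> by (simp add: add.commute)
      qed
      moreover have "c = 6 - 1 / c" using c by (simp add: field_simps)
      moreover have "1 / c - 1 / q n = (q n - c) / (q n * c)"
        using \<open>q n > 0\<close> c by (simp add: field_simps)
      ultimately show ?thesis by linarith
    qed
    also have "\<bar>\<dots>\<bar> \<le> \<bar>(3 / q n - 9) / real (n + 4)\<bar> + \<bar>(q n - c) / (q n * c)\<bar>"
      by (rule abs_triangle_ineq)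
    also have "\<bar>(3 / q n - 9) / real (n + 4)\<bar> \<le> 9 / real (n + 2)"
    proof -
      have "3 / q n \<le> 3 / 2" using q_ge[of n] by (intro divide_left_mono) auto
      moreover have "3 / q n > 0" using \<open>q n > 0\<close> by simp
      ultimately have "\<bar>3 / q n - 9\<bar> \<le> 9" by linarith
      then show ?thesis unfolding abs_divide by (intro frac_le) auto
    qed
    also have "\<bar>(q n - c) / (q n * c)\<bar> \<le> \<bar>q n - c\<bar> / 2"
    proof -
      have "2 * 1 \<le> q n * c" using q_ge[of n] c by (intro mult_mono) auto
      then show ?thesis unfolding abs_divide by (intro frac_le) auto
    qed
    finally show "\<bar>q (Suc n) - c\<bar> \<le> \<bar>q n - c\<bar> / 2 + 9 / real (n + 2)" by linarith
  next
    have "q 0 = 3"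
      using forest_gf_recurrence(2) forest_gf_nth_pos[of 2] by (simp add: q_def eval_nat_numeral)
    moreover have "sqrt 2 \<le> 2" by (simp add: real_le_lsqrt)
    ultimately show "\<bar>q 0 - c\<bar> \<le> 3 * 9" by (simp add: c_def)
  qed simp
  have lim0: "(\<lambda>n. 6 * 9 / real (n + 2)) \<longlonglongrightarrow> 0"
    using LIMSEQ_ignore_initial_segment[OF lim_const_over_n[of "6 * 9"], of 2] by (simp only: of_nat_id)
  have "(\<lambda>n. q n - c) \<longlonglongrightarrow> 0"
    by (rule Lim_null_comparison[OF always_eventually lim0]) (simp only: real_norm_def bound simp_thms)
  then have "q \<longlonglongrightarrow> c" by (rule LIM_zero_cancel)
  then have "(\<lambda>n. forest_gf $ Suc (n + 2) / forest_gf $ (n + 2)) \<longlonglongrightarrow> c"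
    by (simp add: q_def[abs_def] eval_nat_numeral)
  then show ?thesis unfolding c_def by (rule LIMSEQ_offset)
qed

lemma forest_gf_ratio:
  "(\<lambda>n. forest_gf $ n / forest_gf $ (n + j)) \<longlonglongrightarrow> (3 - 2 * sqrt 2) ^ j"
proof (induction j)
  case 0
  show ?case using forest_gf_nth_pos by (simp add: less_imp_neq[symmetric])
next
  case (Suc j)
  have "(3 - 2 * sqrt 2) * (3 + 2 * sqrt 2) = 1" by (simp add: algebra_simps)
  moreover have "3 + 2 * sqrt 2 > 0" by (simp add: add_pos_nonneg)
  ultimately have inv: "inverse (3 + 2 * sqrt 2) = 3 - 2 * sqrt 2"
    by (metis inverse_unique mult.commute)
  have "(\<lambda>n. inverse (forest_gf $ Suc n / forest_gf $ n)) \<longlonglongrightarrow> inverse (3 + 2 * sqrt 2)"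
    using forest_gf_consecutive_ratio \<open>3 + 2 * sqrt 2 > 0\<close> by (intro tendsto_inverse) auto
  then have "(\<lambda>n. forest_gf $ (n + j) / forest_gf $ Suc (n + j)) \<longlonglongrightarrow> 3 - 2 * sqrt 2"
    unfolding inv by (intro LIMSEQ_ignore_initial_segment[of "\<lambda>n. forest_gf $ n / forest_gf $ Suc n"]) simp
  with Suc have "(\<lambda>n. forest_gf $ n / forest_gf $ (n + j) * (forest_gf $ (n + j) / forest_gf $ Suc (n + j)))
      \<longlonglongrightarrow> (3 - 2 * sqrt 2) ^ j * (3 - 2 * sqrt 2)"
    by (rule tendsto_mult)
  moreover have "forest_gf $ (n + j) \<noteq> 0" for n using forest_gf_nth_pos[of "n + j"] by simp
  ultimately show ?case by (simp add: mult.commute)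
qed

text \<open>
  The quadratic equation expresses the ratios for \<open>k + 2\<close> by those for \<open>k + 1\<close> and \<open>k\<close>, and in the
  limit the factor \<open>X\<close> becomes \<open>\<rho> = 3 - 2 sqrt 2\<close>. The limits \<open>L\<close> thus satisfy
  \<open>L (k + 2) = 2 sqrt 2 L (k + 1) - 2 L k\<close> with \<open>L 0 = 0\<close> and \<open>L 1 = 1\<close>. The factor \<open>k\<close> comes from
  the double characteristic root \<open>sqrt 2\<close>. The limit is written as a quotient by \<open>sqrt 2\<close> so that
  \<open>k = 0\<close> is covered without the truncated exponent \<open>k - 1\<close>.
\<close>

lemma forest_gf_power_ratio:
  "(\<lambda>n. forest_gf ^ k $ n / forest_gf $ n) \<longlonglongrightarrow> real k * sqrt 2 ^ k / sqrt 2"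
proof (induction k rule: induct_nat_012)
  case 0
  have "\<forall>\<^sub>F n in sequentially. forest_gf ^ 0 $ n / forest_gf $ n = 0"
    using eventually_gt_at_top[of 0] by eventually_elim simp
  then show ?case by (simp add: tendsto_eventually)
next
  case 1
  show ?case using forest_gf_nth_pos by (simp add: less_imp_neq[symmetric])
next
  case (ge2 k)
  have rec: "forest_gf ^ Suc (Suc k) = fps_const 3 * forest_gf ^ Suc k - fps_X * forest_gf ^ Suc k
      - fps_const 2 * forest_gf ^ k"
  proof -
    have "forest_gf ^ Suc (Suc k) = forest_gf\<^sup>2 * forest_gf ^ k"
      by (simp add: power2_eq_square mult.assoc)
    then show ?thesis
      unfolding forest_gf_square by (simp add: algebra_simps numeral_fps_const)
  qed
  let ?a = "\<lambda>k n. forest_gf ^ k $ n / forest_gf $ n"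
  \<comment> \<open>The recurrence for coefficient \<open>n + 1\<close>, divided by that coefficient of \<open>A\<close>: multiplication by
    \<open>X\<close> shifts the index, which costs one ratio of consecutive coefficients.\<close>
  have "(\<lambda>n. 3 * ?a (Suc k) (Suc n) - ?a (Suc k) n * (forest_gf $ n / forest_gf $ (n + 1)) - 2 * ?a k (Suc n))
      \<longlonglongrightarrow> 3 * (real (Suc k) * sqrt 2 ^ Suc k / sqrt 2)
        - real (Suc k) * sqrt 2 ^ Suc k / sqrt 2 * (3 - 2 * sqrt 2) ^ 1 - 2 * (real k * sqrt 2 ^ k / sqrt 2)"
    by (intro tendsto_intros LIMSEQ_Suc[OF ge2(1)] LIMSEQ_Suc[OF ge2(2)] ge2(2) forest_gf_ratio)
  also have "(\<lambda>n. 3 * ?a (Suc k) (Suc n) - ?a (Suc k) n * (forest_gf $ n / forest_gf $ (n + 1)) - 2 * ?a k (Suc n))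
      = (\<lambda>n. ?a (Suc (Suc k)) (Suc n))"
  proof
    fix n
    have "forest_gf $ n \<noteq> 0" "forest_gf $ Suc n \<noteq> 0"
      using forest_gf_nth_pos[of n] forest_gf_nth_pos[of "Suc n"] by simp_all
    then show "3 * ?a (Suc k) (Suc n) - ?a (Suc k) n * (forest_gf $ n / forest_gf $ (n + 1)) - 2 * ?a k (Suc n)
        = ?a (Suc (Suc k)) (Suc n)"
      unfolding rec by (simp add: diff_divide_distrib del: power_Suc)
  qed
  also have "3 * (real (Suc k) * sqrt 2 ^ Suc k / sqrt 2)
        - real (Suc k) * sqrt 2 ^ Suc k / sqrt 2 * (3 - 2 * sqrt 2) ^ 1 - 2 * (real k * sqrt 2 ^ k / sqrt 2)
      = real (Suc (Suc k)) * sqrt 2 ^ Suc (Suc k) / sqrt 2"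
  proof -
    have sqrt2: "sqrt 2 * (sqrt 2 * z) = 2 * z" for z :: real by (simp flip: mult.assoc)
    show ?thesis by (simp add: field_simps sqrt2)
  qed
  finally show ?case by (subst (asm) filterlim_sequentially_Suc)
qed

section \<open>The limit law of the leaf depth\<close>

lemma leaf_depth_prob_eq:
  "leaf_depth_prob r d (r + m) =
     real (card (marked_trees d r m)) / real (card (schroeder_trees (r + 1 + m)))"
proof -
  have "schroeder_trees (r + m + 1) \<inter> {t. leaf_depths t ! r = d} = marked_trees d r m"
    by (auto simp: marked_trees_def)
  then show ?thesis
    using schroeder_trees_nonempty[of "r + m"] finite_schroeder_trees
    by (simp add: leaf_depth_prob_def random_schroeder_def measure_pmf_of_set)
qed

lemma card_schroeder_trees:
  assumes "n \<ge> 2"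
  shows "real (card (schroeder_trees n)) = forest_gf $ n / 2"
proof -
  have "(fps_const 2 * tree_gf) $ n = (fps_X + forest_gf - 1) $ n"
    using forest_gf_tree_gf by (simp add: numeral_fps_const)
  then show ?thesis using assms by (simp add: tree_gf_def)
qed

text \<open>
  With \<open>r\<close> and \<open>d\<close> fixed, the count of marked trees is a finite combination of coefficients of
  powers of \<open>A\<close> at the number of leaves to the right of the marked one. Comparing them with the
  total count splits into two ratios: the power against \<open>A\<close> at the same index, and a shift of the
  index by \<open>r + 1\<close>, which contributes that power of \<open>\<rho>\<close>. The factor 2 arises because, from two
  leaves on, there are twice as many forests as trees.
\<close>

lemma leaf_depth_prob_tendsto:
  "leaf_depth_prob r d \<longlonglongrightarrow>
     2 * (3 - 2 * sqrt 2) ^ (r + 1) *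
       (\<Sum>k\<le>d. real (d choose k) * (-1) ^ (d - k) * (forest_gf ^ k $ r * (real k * sqrt 2 ^ k / sqrt 2)))"
proof (rule LIMSEQ_offset)
  let ?A = forest_gf
  let ?L = "\<lambda>m. 2 * (?A $ Suc m / ?A $ (Suc m + (r + 1))) *
      (\<Sum>k\<le>d. real (d choose k) * (-1) ^ (d - k) * (?A ^ k $ r * (?A ^ k $ Suc m / ?A $ Suc m)))"
  have "leaf_depth_prob r d (m + (r + 1)) = ?L m" for m
  proof -
    have pos: "?A $ Suc m > 0" "?A $ (Suc m + (r + 1)) > 0" by (rule forest_gf_nth_pos)+
    have "leaf_depth_prob r d (m + (r + 1)) =
        real (card (marked_trees d r (Suc m))) / real (card (schroeder_trees (Suc m + (r + 1))))"
      using leaf_depth_prob_eq[of r d "Suc m"] by (simp add: add_ac)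
    also have "\<dots> = 2 * real (card (marked_trees d r (Suc m))) / ?A $ (Suc m + (r + 1))"
      by (subst card_schroeder_trees) simp_all
    also have "real (card (marked_trees d r (Suc m))) = ?A $ Suc m *
        (\<Sum>k\<le>d. real (d choose k) * (-1) ^ (d - k) * (?A ^ k $ r * (?A ^ k $ Suc m / ?A $ Suc m)))"
      unfolding card_marked_trees sum_distrib_left using pos by (intro sum.cong refl) simp
    finally show ?thesis by simp
  qed
  moreover have "?L \<longlonglongrightarrow> 2 * (3 - 2 * sqrt 2) ^ (r + 1) *
       (\<Sum>k\<le>d. real (d choose k) * (-1) ^ (d - k) * (?A ^ k $ r * (real k * sqrt 2 ^ k / sqrt 2)))"
    by (intro tendsto_intros LIMSEQ_Suc[OF forest_gf_ratio] LIMSEQ_Suc[OF forest_gf_power_ratio])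
  ultimately show "(\<lambda>m. leaf_depth_prob r d (m + (r + 1))) \<longlonglongrightarrow> 2 * (3 - 2 * sqrt 2) ^ (r + 1) *
       (\<Sum>k\<le>d. real (d choose k) * (-1) ^ (d - k) * (?A ^ k $ r * (real k * sqrt 2 ^ k / sqrt 2)))"
    by (simp only:)
qed

text \<open>
  This is \<open>x\<close> times the derivative of \<open>(x + y)\<^sup>d\<close> with respect to \<open>x\<close>; it is proved by absorption,
  \<open>k (d choose k) = d (d - 1 choose k - 1)\<close>.
\<close>

lemma weighted_binomial_sum:
  fixes x y :: "'a::comm_ring_1"
  shows "(\<Sum>k\<le>d. of_nat (d choose k) * y ^ (d - k) * (of_nat k * x ^ k)) =
    of_nat d * x * (x + y) ^ (d - 1)"
proof (cases d)
  case (Suc e)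
  have "(\<Sum>k\<le>d. of_nat (d choose k) * y ^ (d - k) * (of_nat k * x ^ k)) =
      (\<Sum>k\<le>e. of_nat (Suc k * (Suc e choose Suc k)) * y ^ (e - k) * x ^ Suc k)"
    unfolding Suc sum.atMost_Suc_shift by (simp add: mult_ac del: binomial_Suc_Suc of_nat_Suc mult_Suc)
  also have "\<dots> = of_nat d * x * (\<Sum>k\<le>e. of_nat (e choose k) * x ^ k * y ^ (e - k))"
    unfolding Suc_times_binomial sum_distrib_left Suc
    by (intro sum.cong refl) (simp add: mult_ac del: of_nat_Suc mult_Suc)
  finally show ?thesis by (simp add: Suc binomial_ring)
qed simp

section \<open>The generating function\<close>

text \<open>
  The series \<open>A(\<rho> x)\<close>: the rescaling absorbs the factor \<open>\<rho>\<close> to the power \<open>r\<close> of the limit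
  probabilities.
\<close>

definition rescaled_forest_gf :: "real fps" where
  "rescaled_forest_gf = forest_gf oo (fps_const (3 - 2 * sqrt 2) * fps_X)"

lemma rescaled_forest_gf_power_nth: "rescaled_forest_gf ^ k $ r = (3 - 2 * sqrt 2) ^ r * forest_gf ^ k $ r"
proof -
  have "rescaled_forest_gf ^ k = forest_gf ^ k oo (fps_const (3 - 2 * sqrt 2) * fps_X)"
    unfolding rescaled_forest_gf_def by (rule fps_compose_power) simp
  then show ?thesis by (simp add: fps_compose_linear)
qed

lemma rescaled_forest_gf_nth_0: "rescaled_forest_gf $ 0 = 1"
  using rescaled_forest_gf_power_nth[of 1 0] by (simp add: forest_gf_nth schroeder_forests_0)

lemma rescaled_forest_gf_square:
  "rescaled_forest_gf\<^sup>2 = (3 - fps_const (3 - 2 * sqrt 2) * fps_X) * rescaled_forest_gf - 2"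
proof -
  have "rescaled_forest_gf\<^sup>2 = forest_gf\<^sup>2 oo (fps_const (3 - 2 * sqrt 2) * fps_X)"
    unfolding rescaled_forest_gf_def by (rule fps_compose_power) simp
  then show ?thesis
    unfolding forest_gf_square
    by (simp add: fps_compose_mult_distrib fps_compose_sub_distrib rescaled_forest_gf_def)
qed

lemma leaf_depth_gf_nth:
  defines B_def: "B \<equiv> fps_const (sqrt 2) * rescaled_forest_gf"
  shows "leaf_depth_gf $ d = fps_const (sqrt 2 * (3 - 2 * sqrt 2)) * (of_nat d * B * (B - 1) ^ (d - 1))"
proof (rule fps_ext)
  fix r
  let ?\<rho> = "3 - 2 * sqrt 2"
  let ?S = "\<Sum>k\<le>d. real (d choose k) * (-1) ^ (d - k) * (forest_gf ^ k $ r * (real k * sqrt 2 ^ k / sqrt 2))"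
  have "leaf_depth_limit r d = 2 * ?\<rho> ^ (r + 1) * ?S"
    unfolding leaf_depth_limit_def by (rule limI) (rule leaf_depth_prob_tendsto)
  then have "leaf_depth_gf $ d $ r = 2 * ?\<rho> ^ (r + 1) * ?S"
    by (cases "d = 0") (simp_all add: leaf_depth_gf_def Suc_le_eq)
  also have "\<dots> = (\<Sum>k\<le>d. sqrt 2 * ?\<rho> *
      (real (d choose k) * (-1) ^ (d - k) * (real k * (sqrt 2 ^ k * (?\<rho> ^ r * forest_gf ^ k $ r)))))"
    unfolding sum_distrib_left by (intro sum.cong refl) (simp add: field_simps)
  also have "\<dots> = (\<Sum>k\<le>d. fps_const (sqrt 2 * ?\<rho>) *
      (fps_const (real (d choose k) * (-1) ^ (d - k)) * (fps_const (real k) * B ^ k))) $ r"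
    by (simp add: fps_sum_nth B_def power_mult_distrib fps_const_power rescaled_forest_gf_power_nth
        del: fps_const_mult)
  also have "(\<Sum>k\<le>d. fps_const (sqrt 2 * ?\<rho>) *
      (fps_const (real (d choose k) * (-1) ^ (d - k)) * (fps_const (real k) * B ^ k))) =
      fps_const (sqrt 2 * ?\<rho>) * (\<Sum>k\<le>d. of_nat (d choose k) * (-1) ^ (d - k) * (of_nat k * B ^ k))"
    unfolding sum_distrib_left
    by (simp add: fps_of_nat flip: fps_const_mult fps_const_power fps_const_neg)
  also have "\<dots> = fps_const (sqrt 2 * ?\<rho>) * (of_nat d * B * (B - 1) ^ (d - 1))"
    unfolding weighted_binomial_sum by simp
  finally show "leaf_depth_gf $ d $ r =
      (fps_const (sqrt 2 * ?\<rho>) * (of_nat d * B * (B - 1) ^ (d - 1))) $ r" .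
qed

text \<open>
  Multiplying once by \<open>1 - c X\<close> leaves \<open>X\<close> times the geometric series, and multiplying a second time
  removes that series.
\<close>

lemma fps_derivative_of_geometric_series:
  fixes c :: "'a::comm_ring_1"
  shows "(1 - fps_const c * fps_X)\<^sup>2 * Abs_fps (\<lambda>d. of_nat d * c ^ (d - 1)) = fps_X"
proof -
  have 1: "(1 - fps_const c * fps_X) * Abs_fps (\<lambda>d. of_nat d * c ^ (d - 1)) = fps_X * Abs_fps (\<lambda>d. c ^ d)"
  proof (rule fps_ext)
    fix n
    show "((1 - fps_const c * fps_X) * Abs_fps (\<lambda>d. of_nat d * c ^ (d - 1))) $ n =
        (fps_X * Abs_fps (\<lambda>d. c ^ d)) $ n"
    proof (cases n)
      case (Suc m)
      then show ?thesis by (cases m) (simp_all add: left_diff_distrib mult.assoc algebra_simps)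
    qed (simp add: left_diff_distrib mult.assoc)
  qed
  have 2: "(1 - fps_const c * fps_X) * Abs_fps (\<lambda>d. c ^ d) = 1"
  proof (rule fps_ext)
    show "((1 - fps_const c * fps_X) * Abs_fps (\<lambda>d. c ^ d)) $ n = 1 $ n" for n
      by (cases n) (simp_all add: left_diff_distrib mult.assoc)
  qed
  show ?thesis
    unfolding power2_eq_square mult.assoc 1 mult.left_commute[of _ fps_X] 2 by simp
qed

lemma leaf_depth_gf_eq:
  defines B_def: "B \<equiv> fps_const (sqrt 2) * rescaled_forest_gf"
  shows "(1 - fps_const (B - 1) * var_y)\<^sup>2 * leaf_depth_gf =
    const_xy (sqrt 2 * (3 - 2 * sqrt 2)) * fps_const B * var_y"
proof -
  define F where "F = Abs_fps (\<lambda>d. of_nat d * (B - 1) ^ (d - 1))"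
  have gf: "leaf_depth_gf = const_xy (sqrt 2 * (3 - 2 * sqrt 2)) * fps_const B * F"
    unfolding B_def F_def by (rule fps_ext) (simp add: leaf_depth_gf_nth const_xy_def mult_ac)
  have "(1 - fps_const (B - 1) * var_y)\<^sup>2 * leaf_depth_gf =
      const_xy (sqrt 2 * (3 - 2 * sqrt 2)) * fps_const B * ((1 - fps_const (B - 1) * var_y)\<^sup>2 * F)"
    unfolding gf by (simp only: mult_ac)
  also have "(1 - fps_const (B - 1) * var_y)\<^sup>2 * F = var_y"
    unfolding F_def var_y_def by (rule fps_derivative_of_geometric_series)
  finally show ?thesis .
qed

text \<open>
  Since \<open>\<rho>\<^sup>2 = 6 \<rho> - 1\<close>, substituting \<open>\<rho> x\<close> into \<open>1 - 6 t + t\<^sup>2\<close> gives the product under the root.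
  The formal square root is determined by its square and its constant term 1.
\<close>

lemma rescaled_forest_gf_sqrt:
  "sqrt_x ((1 - fps_X) * (1 - fps_const ((3 - 2 * sqrt 2)\<^sup>2) * fps_X)) =
     fps_const (3 - fps_const (3 - 2 * sqrt 2) * fps_X - 2 * rescaled_forest_gf)"
proof -
  define \<rho> :: real where "\<rho> = 3 - 2 * sqrt 2"
  let ?P = "(1 - fps_X) * (1 - fps_const (\<rho>\<^sup>2) * fps_X)"
  define f where "f = 3 - fps_const \<rho> * fps_X - 2 * rescaled_forest_gf"
  have rho: "\<rho>\<^sup>2 = 6 * \<rho> - 1" by (simp add: \<rho>_def power2_eq_square algebra_simps)
  have "f\<^sup>2 = (3 - fps_const \<rho> * fps_X)\<^sup>2 - 4 * ((3 - fps_const \<rho> * fps_X) * rescaled_forest_gf - rescaled_forest_gf\<^sup>2)"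
    unfolding f_def by (simp add: power2_eq_square algebra_simps)
  also have "\<dots> = (3 - fps_const \<rho> * fps_X)\<^sup>2 - 8"
    unfolding rescaled_forest_gf_square \<rho>_def[symmetric] by simp
  also have "\<dots> = 1 - fps_const (6 * \<rho>) * fps_X + fps_const (\<rho>\<^sup>2) * fps_X\<^sup>2"
    by (simp add: power2_eq_square algebra_simps numeral_fps_const)
  also have "\<dots> = ?P"
    by (simp add: rho[unfolded power2_eq_square] power2_eq_square algebra_simps flip: fps_const_sub fps_const_add)
  finally have f2: "f ^ Suc 1 = ?P" by (simp add: numeral_2_eq_2)
  have "f = fps_radical root (Suc 1) ?P"
    by (rule iffD1[OF radical_unique, OF _ _ _ f2]) (simp_all add: f_def rescaled_forest_gf_nth_0)
  then show ?thesis by (simp add: sqrt_x_def \<rho>_def f_def numeral_2_eq_2)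
qed

text \<open>
  The claim that the two fractions for the generating function agree, cleared of denominators:
  here \<open>s\<close> stands for \<open>sqrt 2\<close>, \<open>a\<close> for \<open>A(\<rho> x)\<close>, and \<open>3 - 2 s\<close> and \<open>3 + 2 s\<close> for \<open>\<rho>\<close> and its inverse.
  Multiplied by \<open>\<rho>\<close>, the first factor on the left is
  \<open>2 (1 + y)\<^sup>2 (3 - \<rho> x) - 8 s y (1 + y) - 2 a (1 - y) (1 + 3 y)\<close>; after multiplication by \<open>2 a\<close>, the
  equation for \<open>a\<close> removes \<open>x\<close> and leaves a perfect square.
\<close>

lemma denominator_identity:
  fixes s a x y :: "'a::comm_ring_1"
  assumes s: "s * s = 2" and a: "a\<^sup>2 = (3 - (3 - 2 * s) * x) * a - 2"
  shows "(9 - 14 * y + 13 * y\<^sup>2 + 6 * s * (1 - y)\<^sup>2 - (1 + 2 * y + 5 * y\<^sup>2) * x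
      + (3 + 2 * s) * (1 - y) * (1 + 3 * y) * (3 - (3 - 2 * s) * x - 2 * a))
      * (s * (3 - 2 * s) * (s * a)) = 8 * (1 - (s * a - 1) * y)\<^sup>2"
proof -
  have s': "s * (s * z) = 2 * z" for z by (simp add: s flip: mult.assoc)
  have aa: "a * a = (3 - (3 - 2 * s) * x) * a - 2" using a by (simp add: power2_eq_square)
  have aa': "a * (a * z) = ((3 - (3 - 2 * s) * x) * a - 2) * z" for z by (simp only: aa flip: mult.assoc)
  show ?thesis by (simp add: algebra_simps power2_eq_square s s' aa aa')
qed

theorem theorem4p4:
  fixes \<rho> :: real
  assumes "\<rho> = 3 - 2 * sqrt 2"
  shows "(\<forall>r d. d \<ge> 1 \<longrightarrow> convergent (leaf_depth_prob r d)) \<and>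
    leaf_depth_gf =
      8 * var_y /
      (9 - 14 * var_y + 13 * var_y\<^sup>2 + const_xy (6 * sqrt 2) * (1 - var_y)\<^sup>2 - (1 + 2 * var_y + 5 * var_y\<^sup>2) * var_x
       + const_xy (inverse \<rho>) * (1 - var_y) * (1 + 3 * var_y)
         * sqrt_x ((1 - fps_X) * (1 - fps_const (\<rho>\<^sup>2) * fps_X)))"
proof -
  define s where "s = const_xy (sqrt 2)"
  define a where "a = fps_const rescaled_forest_gf"
  define D where "D = 9 - 14 * var_y + 13 * var_y\<^sup>2 + const_xy (6 * sqrt 2) * (1 - var_y)\<^sup>2
       - (1 + 2 * var_y + 5 * var_y\<^sup>2) * var_x
       + const_xy (inverse \<rho>) * (1 - var_y) * (1 + 3 * var_y)
         * sqrt_x ((1 - fps_X) * (1 - fps_const (\<rho>\<^sup>2) * fps_X))"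
  have const_xy_simps: "const_xy (u * v) = const_xy u * const_xy v" "const_xy (u + v) = const_xy u + const_xy v"
      "const_xy (u - v) = const_xy u - const_xy v" "const_xy (numeral k) = numeral k" for u v k
    by (simp_all add: const_xy_def numeral_fps_const)
  have "(3 - 2 * sqrt 2) * (3 + 2 * sqrt 2) = 1" by (simp add: algebra_simps)
  then have inv: "inverse \<rho> = 3 + 2 * sqrt 2" by (simp add: assms inverse_unique)
  have ss: "s * s = 2"
    unfolding s_def const_xy_simps(1)[symmetric] by (simp add: const_xy_simps)
  have sa: "fps_const (fps_const (sqrt 2) * rescaled_forest_gf) = s * a"
      "fps_const (fps_const (sqrt 2) * rescaled_forest_gf - 1) = s * a - 1"
    by (simp_all add: s_def a_def const_xy_def flip: fps_const_1_eq_1)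
  have rho_x: "fps_const (fps_const \<rho> * fps_X) = (3 - 2 * s) * var_x"
  proof -
    have "fps_const (fps_const \<rho> * fps_X) = const_xy \<rho> * var_x"
      by (simp add: const_xy_def var_x_def)
    then show ?thesis by (simp only: assms s_def const_xy_simps)
  qed
  have a2: "a\<^sup>2 = (3 - (3 - 2 * s) * var_x) * a - 2"
  proof -
    have "a\<^sup>2 = fps_const (rescaled_forest_gf\<^sup>2)" by (simp add: a_def fps_const_power)
    also have "\<dots> = (3 - fps_const (fps_const \<rho> * fps_X)) * a - 2"
      unfolding rescaled_forest_gf_square assms[symmetric] a_def by (simp add: numeral_fps_const)
    finally show ?thesis unfolding rho_x .
  qed
  have R: "sqrt_x ((1 - fps_X) * (1 - fps_const (\<rho>\<^sup>2) * fps_X)) = 3 - (3 - 2 * s) * var_x - 2 * a"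
  proof -
    have "sqrt_x ((1 - fps_X) * (1 - fps_const (\<rho>\<^sup>2) * fps_X)) =
        3 - fps_const (fps_const \<rho> * fps_X) - 2 * a"
      unfolding assms rescaled_forest_gf_sqrt a_def by (simp add: numeral_fps_const)
    then show ?thesis unfolding rho_x .
  qed
  have D: "D = 9 - 14 * var_y + 13 * var_y\<^sup>2 + 6 * s * (1 - var_y)\<^sup>2 - (1 + 2 * var_y + 5 * var_y\<^sup>2) * var_x
      + (3 + 2 * s) * (1 - var_y) * (1 + 3 * var_y) * (3 - (3 - 2 * s) * var_x - 2 * a)"
    unfolding D_def R inv by (simp only: const_xy_simps s_def)
  have "(1 - (s * a - 1) * var_y)\<^sup>2 * leaf_depth_gf = s * (3 - 2 * s) * (s * a) * var_y"
    using leaf_depth_gf_eq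
    by (simp only: sa const_xy_simps flip: s_def)
  then have "D * (s * (3 - 2 * s) * (s * a)) * leaf_depth_gf = 8 * (s * (3 - 2 * s) * (s * a) * var_y)"
    unfolding D denominator_identity[OF ss a2] by (simp only: mult.assoc)
  then have "s * (3 - 2 * s) * (s * a) * (leaf_depth_gf * D) = s * (3 - 2 * s) * (s * a) * (8 * var_y)"
    by (simp only: mult_ac)
  moreover have "s * (3 - 2 * s) * (s * a) \<noteq> 0"
  proof -
    have "s * (3 - 2 * s) * (s * a) = const_xy (sqrt 2 * \<rho> * sqrt 2) * a"
      by (simp add: assms s_def const_xy_simps mult_ac)
    moreover have "rescaled_forest_gf \<noteq> 0" using rescaled_forest_gf_nth_0 by auto
    moreover have "\<rho> \<noteq> 0" using \<open>(3 - 2 * sqrt 2) * (3 + 2 * sqrt 2) = 1\<close> assms by auto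
    ultimately show ?thesis by (simp add: const_xy_def a_def)
  qed
  ultimately have gf: "leaf_depth_gf * D = 8 * var_y" by (metis mult_left_cancel)
  have "D $ 0 $ 0 = 9 + 6 * sqrt 2 + inverse \<rho>"
    unfolding D_def rescaled_forest_gf_sqrt[folded assms]
    by (simp add: var_y_def var_x_def const_xy_def power2_eq_square rescaled_forest_gf_nth_0)
  moreover have "9 + 6 * sqrt 2 + inverse \<rho> > 0"
    unfolding inv by (simp add: add_pos_nonneg)
  ultimately have D0: "D $ 0 $ 0 \<noteq> 0" by simp
  then have "D \<noteq> 0" by auto
  have "8 * var_y / D * D = leaf_depth_gf * D"
    unfolding gf by (rule fps_fps_divide_mult_cancel[OF D0])
  then have "leaf_depth_gf = 8 * var_y / D" using \<open>D \<noteq> 0\<close> by (metis mult_right_cancel)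
  moreover have "convergent (leaf_depth_prob r d)" for r d
    using leaf_depth_prob_tendsto by (rule convergentI)
  ultimately show ?thesis unfolding D_def by blast
qed

end
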